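(* Let $1\le q<3$, $m\in\mathbb{R}$, $\sigma>0$, and let $X$ be a real random variable following the $q$-Gaussian distribution $N_q(m,\sigma^2)$, with density $f$. Then: 1. the normalized $q$-mean of $X$ is $$\overline{E}_q(X)=\int_{-\infty}^{+\infty}x\,\frac{[f(x)]^q}{\nu_q(f)}\,dx=m;$$ 2. the normalized $q$-variance of $X$ is $$\overline{V}_{2q-1}(X)=\int_{-\infty}^{+\infty}(x-m)^2\,\frac{[f(x)]^{2q-1}}{\nu_{2q-1}(f)}\,dx=\frac{3-q}{q+1}\,\sigma^2 .$$
   Context: For real $q$ and $u$, the $q$-exponential is $e_q^{u}=e_q(u)=[1+(1-q)u]_+^{1/(1-q)}$ for $q\ne 1$, and $e_1^{u}=\exp(u)$. For $1\le q<3$ put $\beta=\frac{1}{3-q}$ and $C_q=\int_{-\infty}^{\infty}e_q^{-x^2}\,dx$, so that $C_1=\sqrt{\pi}$ and $C_q=\left(\frac{1}{q-1}\right)^{1/2}B\!\left(\frac{3-q}{2(q-1)},\frac12\right)$ for $1<q<3$, where $B$ is the beta function. The $q$-Gaussian distribution $N_q(m,\sigma^2)$ has density $f(x)=\frac{\sqrt{\beta}}{\sigma C_q}e_q^{-\beta(x-m)^2/\sigma^2}$, $x\in\mathbb{R}$. For a density $f$ and real $r$, $\nu_r(f)=\int_{-\infty}^{+\infty}[f(x)]^r\,dx$ (assumed finite), and $[f(x)]^r/\nu_r(f)$ is the normalized (escort) density of order $r$. *)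

theory Defs
  imports "HOL-Probability.Probability"
begin

text \<open>For \<open>q > 1\<close> and \<open>1 + (1 - q) * u \<le> 0\<close> the exponent is negative and the value below is
  \<open>0 powr _ = 0\<close>; this never occurs for \<open>q \<ge> 1\<close> and \<open>u \<le> 0\<close>.\<close>

definition q_exp :: "real \<Rightarrow> real \<Rightarrow> real" where
  "q_exp q u = (if q = 1 then exp u else max 0 (1 + (1 - q) * u) powr (1 / (1 - q)))"

definition q_gaussian_const :: "real \<Rightarrow> real" where
  "q_gaussian_const q = (\<integral>x. q_exp q (- x\<^sup>2) \<partial>lborel)"

text \<open>As for \<^const>\<open>normal_density\<close>, the scale argument is \<open>\<sigma>\<close>, not \<open>\<sigma>\<^sup>2\<close>.\<close>

definition q_gaussian_density :: "real \<Rightarrow> real \<Rightarrow> real \<Rightarrow> real \<Rightarrow> real" where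
  "q_gaussian_density q m \<sigma> x =
    (let \<beta> = 1 / (3 - q)
     in sqrt \<beta> / (\<sigma> * q_gaussian_const q) * q_exp q (- \<beta> * (x - m)\<^sup>2 / \<sigma>\<^sup>2))"

definition q_gaussian :: "real \<Rightarrow> real \<Rightarrow> real \<Rightarrow> real measure" where
  "q_gaussian q m \<sigma> = density lborel (\<lambda>x. ennreal (q_gaussian_density q m \<sigma> x))"

definition nu :: "real \<Rightarrow> (real \<Rightarrow> real) \<Rightarrow> real" where
  "nu r f = (\<integral>x. f x powr r \<partial>lborel)"

definition escort_density :: "real \<Rightarrow> (real \<Rightarrow> real) \<Rightarrow> real \<Rightarrow> real" where
  "escort_density r f x = f x powr r / nu r f"

definition normalized_mean :: "real \<Rightarrow> (real \<Rightarrow> real) \<Rightarrow> real" where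
  "normalized_mean r f = (\<integral>x. x * escort_density r f x \<partial>lborel)"

text \<open>The centre \<open>c\<close> is a separate argument because the order \<open>r\<close> of the escort density differs
  from the order used for the mean.\<close>

definition normalized_variance :: "real \<Rightarrow> real \<Rightarrow> (real \<Rightarrow> real) \<Rightarrow> real" where
  "normalized_variance r c f = (\<integral>x. (x - c)\<^sup>2 * escort_density r f x \<partial>lborel)"

end

theory Submission
  imports Defs
begin

text \<open>
  Write \<open>E(x) = e\<^sub>q(-a x\<^sup>2)\<close> with \<open>a = 1 / ((3 - q) \<sigma>\<^sup>2)\<close>. The density of \<open>N\<^sub>q(m, \<sigma>\<^sup>2)\<close> is
  \<open>K E(x - m)\<close> for a constant \<open>K > 0\<close>, and \<open>K\<close> cancels in every escort density
  (\<open>escort_of_shifted_profile\<close>), so it suffices to compare moments of powers of \<open>E\<close>.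

  The mean is \<open>m\<close> because \<open>x E(x)\<^sup>q\<close> is odd. For the variance put \<open>r = 2q - 1\<close>,
  \<open>N = \<integral> E\<^sup>r\<close> and \<open>V = \<integral> x\<^sup>2 E\<^sup>r\<close>. Since \<open>e\<^sub>q\<close> solves \<open>y' = y\<^sup>q\<close>, the derivative of
  \<open>x E\<^sup>q\<close> is \<open>E\<^sup>q - 2 a q x\<^sup>2 E\<^sup>r\<close>, and as \<open>x E\<^sup>q\<close> vanishes at both ends
  (\<open>q_profile_integration_by_parts\<close>), \<open>\<integral> E\<^sup>q = 2 a q V\<close>. On the other hand
  \<open>E\<^sup>q = (1 + (q - 1) a x\<^sup>2) E\<^sup>r\<close> (\<open>q_exp_powr_order_relation\<close>), whence
  \<open>\<integral> E\<^sup>q = N + (q - 1) a V\<close>. Eliminating \<open>\<integral> E\<^sup>q\<close> leaves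
  \<open>V / N = 1 / (a (q + 1)) = (3 - q) \<sigma>\<^sup>2 / (q + 1)\<close>.

  Neither identity singles out \<open>q = 1\<close>. The same holds for the finiteness of the integrals:
  since \<open>E \<le> 1\<close>, powers of order at least 1 are dominated by \<open>E\<close>, and
  \<open>q_exp_powr_times_arg_le\<close> bounds \<open>x\<^sup>2 E\<^sup>q\<close> by a multiple of \<open>e\<^sub>q(-a x\<^sup>2 / 2)\<close>. The
  integrability of \<open>e\<^sub>q(-x\<^sup>2)\<close> itself is read off from the existence of the random variable.
\<close>

section \<open>The q-exponential on the nonpositive half-line\<close>

lemma q_exp_base_ge_1:
  fixes q u :: real
  assumes "1 \<le> q" "u \<le> 0"
  shows "1 \<le> 1 + (1 - q) * u"
  using mult_nonpos_nonpos[of "1 - q" u] assms by simp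

lemma q_exp_nonpos_eq:
  assumes "1 \<le> q" "u \<le> 0" "q \<noteq> 1"
  shows "q_exp q u = (1 + (1 - q) * u) powr (1 / (1 - q))"
  using q_exp_base_ge_1[OF assms(1,2)] assms(3) by (simp add: q_exp_def max_def)

lemma q_exp_pos:
  assumes "1 \<le> q" "u \<le> 0"
  shows "0 < q_exp q u"
  using q_exp_base_ge_1[OF assms] by (auto simp: q_exp_def)

lemma q_exp_nonneg: "0 \<le> q_exp q u"
  by (simp add: q_exp_def)

lemma q_exp_le_1:
  assumes "1 \<le> q" "u \<le> 0"
  shows "q_exp q u \<le> 1"
proof (cases "q = 1")
  case True
  then show ?thesis using assms by (simp add: q_exp_def)
next
  case False
  have "(1 + (1 - q) * u) powr (1 / (1 - q)) \<le> (1 + (1 - q) * u) powr 0"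
    using q_exp_base_ge_1[OF assms] False assms by (intro powr_mono) auto
  then show ?thesis
    using q_exp_nonpos_eq[OF assms False] q_exp_base_ge_1[OF assms] by simp
qed

lemma q_exp_measurable [measurable]: "q_exp q \<in> borel_measurable borel"
  unfolding q_exp_def by measurable

lemma q_exp_powr_le:
  assumes "1 \<le> q" "u \<le> 0" "r \<le> s"
  shows "q_exp q u powr s \<le> q_exp q u powr r"
  using powr_mono'[OF assms(3)] q_exp_pos[OF assms(1,2)] q_exp_le_1[OF assms(1,2)] by simp

text \<open>Inverting the q-exponential gives \<open>e\<^sub>q(u)\<^bsup>1-q\<^esup> = 1 + (1 - q) u\<close>; multiplying by
  \<open>e\<^sub>q(u)\<^bsup>2q-1\<^esup>\<close> turns this into a linear relation between the powers of order \<open>q\<close> and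
  \<open>2q - 1\<close>, valid for \<open>q = 1\<close> as well.\<close>

lemma q_exp_powr_order_relation:
  assumes "1 \<le> q" "u \<le> 0"
  shows "q_exp q u powr q = (1 + (1 - q) * u) * q_exp q u powr (2 * q - 1)"
proof (cases "q = 1")
  case True
  then show ?thesis by simp
next
  case False
  have "q_exp q u powr (1 - q) = 1 + (1 - q) * u"
    using q_exp_nonpos_eq[OF assms False] q_exp_base_ge_1[OF assms] False
    by (simp add: powr_powr)
  moreover have "q_exp q u powr q = q_exp q u powr (1 - q) * q_exp q u powr (2 * q - 1)"
    by (simp flip: powr_add)
  ultimately show ?thesis by simp
qed

lemma q_exp_has_real_derivative:
  assumes "1 \<le> q" "u \<le> 0"
  shows "(q_exp q has_real_derivative q_exp q u powr q) (at u)"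
proof (cases "q = 1")
  case True
  have "q_exp q = exp" using True by (auto simp: q_exp_def)
  then show ?thesis using True by (simp add: DERIV_exp)
next
  case False
  then have q: "q > 1" using assms by simp
  have base: "1 \<le> 1 + (1 - q) * u" by (rule q_exp_base_ge_1[OF assms])
  have "((\<lambda>v. (1 + (1 - q) * v) powr (1 / (1 - q))) has_real_derivative
          (1 + (1 - q) * u) powr (1 / (1 - q) - 1)) (at u)"
    using base q by (auto intro!: derivative_eq_intros)
  moreover have "(1 + (1 - q) * u) powr (1 / (1 - q) - 1) = q_exp q u powr q"
  proof -
    have "1 / (1 - q) - 1 = 1 / (1 - q) * q" using q by (simp add: field_simps)
    then show ?thesis
      using q_exp_nonpos_eq[OF assms False] by (simp add: powr_powr)
  qed
  ultimately have "((\<lambda>v. (1 + (1 - q) * v) powr (1 / (1 - q))) has_real_derivative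
          q_exp q u powr q) (at u)" by simp
  then show ?thesis
  proof (rule has_field_derivative_transform_within_open)
    show "open {v. 0 < 1 + (1 - q) * v}"
      by (intro open_Collect_less continuous_intros)
    show "u \<in> {v. 0 < 1 + (1 - q) * v}" using base by simp
    show "(1 + (1 - q) * v) powr (1 / (1 - q)) = q_exp q v"
      if "v \<in> {v. 0 < 1 + (1 - q) * v}" for v
      using that False by (simp add: q_exp_def max_def)
  qed
qed

text \<open>The mean value theorem between \<open>2u\<close> and \<open>u\<close>: the derivative \<open>e\<^sub>q\<^sup>q\<close> is increasing, so
  the increment of \<open>e\<^sub>q\<close> is at least \<open>-u e\<^sub>q(2u)\<^sup>q\<close>. This trades a factor \<open>u\<close> for a change of
  scale, and thereby controls second moments by the integral of \<open>e\<^sub>q(-x\<^sup>2)\<close> for all \<open>q\<close> at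
  once.\<close>

lemma q_exp_powr_times_arg_le:
  assumes "1 \<le> q" "u \<le> 0"
  shows "- u * q_exp q (2 * u) powr q \<le> q_exp q u"
proof (cases "u = 0")
  case True
  then show ?thesis by (simp add: q_exp_nonneg)
next
  case False
  then have u: "u < 0" using assms by simp
  have "\<exists>z>2 * u. z < u \<and> q_exp q u - q_exp q (2 * u) = (u - 2 * u) * q_exp q z powr q"
    using u by (intro MVT2 q_exp_has_real_derivative[OF assms(1)]) auto
  then obtain z where z: "2 * u < z" "z < u"
    "q_exp q u - q_exp q (2 * u) = - u * q_exp q z powr q" by auto
  have "q_exp q (2 * u) \<le> q_exp q z"
  proof (rule DERIV_nonneg_imp_nondecreasing[of "2 * u" z "q_exp q"])
    show "2 * u \<le> z" using z by simp
    show "\<exists>y. (q_exp q has_real_derivative y) (at x) \<and> 0 \<le> y" if "2 * u \<le> x" "x \<le> z" for x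
      using q_exp_has_real_derivative[OF assms(1), of x] that z u
      by (intro exI[of _ "q_exp q x powr q"]) auto
  qed
  then have "q_exp q (2 * u) powr q \<le> q_exp q z powr q"
    using assms by (intro powr_mono2 q_exp_nonneg) auto
  then have "- u * q_exp q (2 * u) powr q \<le> - u * q_exp q z powr q"
    using u by (intro mult_left_mono) auto
  also have "\<dots> \<le> q_exp q u" using z(3) q_exp_nonneg[of q "2 * u"] by linarith
  finally show ?thesis .
qed

section \<open>Moments of powers of the centred q-Gaussian profile\<close>

lemma q_profile_integrable:
  assumes "integrable lborel (\<lambda>x. q_exp q (- x\<^sup>2))" "0 < b"
  shows "integrable lborel (\<lambda>x. q_exp q (- b * x\<^sup>2))"
  using lborel_integrable_real_affine[OF assms(1), of "sqrt b" 0] assms(2)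
  by (simp add: power_mult_distrib)

text \<open>Integrability of \<open>e\<^sub>q(-x\<^sup>2)\<close> stands in for the bound \<open>q < 3\<close>: every integral below is
  dominated by rescaled copies of this one.\<close>

context
  fixes q a :: real
  assumes q: "1 \<le> q" and a: "0 < a"
    and int1: "integrable lborel (\<lambda>x. q_exp q (- x\<^sup>2))"
begin

lemma q_profile_powr_integrable:
  assumes "1 \<le> r"
  shows "integrable lborel (\<lambda>x. q_exp q (- a * x\<^sup>2) powr r)"
proof (rule Bochner_Integration.integrable_bound[OF q_profile_integrable[OF int1 a]])
  have "q_exp q (- a * x\<^sup>2) powr r \<le> q_exp q (- a * x\<^sup>2)" for x
    using q_exp_powr_le[OF q _ assms, of "- a * x\<^sup>2"] q_exp_nonneg[of q "- a * x\<^sup>2"] a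
    by simp
  then show "AE x in lborel. norm (q_exp q (- a * x\<^sup>2) powr r) \<le> norm (q_exp q (- a * x\<^sup>2))"
    by (simp add: q_exp_nonneg)
qed measurable

lemma q_profile_powr_integral_pos:
  assumes "1 \<le> r"
  shows "0 < (\<integral>x. q_exp q (- a * x\<^sup>2) powr r \<partial>lborel)"
proof -
  have pos: "q_exp q (- a * x\<^sup>2) powr r > 0" for x
    using q_exp_pos[OF q, of "- a * x\<^sup>2"] a by simp
  have "(\<integral>x. q_exp q (- a * x\<^sup>2) powr r \<partial>lborel) \<noteq> 0"
  proof
    assume "(\<integral>x. q_exp q (- a * x\<^sup>2) powr r \<partial>lborel) = 0"
    then have "AE x in lborel. q_exp q (- a * x\<^sup>2) powr r = 0"
      by (subst (asm) integral_nonneg_eq_0_iff_AE[OF q_profile_powr_integrable[OF assms]]) auto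
    then have "AE x in (lborel :: real measure). False"
      by eventually_elim (use pos in \<open>auto simp: less_le\<close>)
    then show False by (simp add: AE_iff_null emeasure_lborel_UNIV null_sets_def)
  qed
  moreover have "0 \<le> (\<integral>x. q_exp q (- a * x\<^sup>2) powr r \<partial>lborel)" by simp
  ultimately show ?thesis by linarith
qed

lemma q_profile_square_bound:
  "x\<^sup>2 * q_exp q (- a * x\<^sup>2) powr q \<le> 2 / a * q_exp q (- (a / 2) * x\<^sup>2)"
proof -
  have "a / 2 * x\<^sup>2 * q_exp q (- a * x\<^sup>2) powr q \<le> q_exp q (- (a / 2) * x\<^sup>2)"
    using q_exp_powr_times_arg_le[OF q, of "- (a / 2) * x\<^sup>2"] a by simp
  then show ?thesis using a by (simp add: field_simps)
qed

lemma q_profile_square_integrable: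
  "integrable lborel (\<lambda>x. x\<^sup>2 * q_exp q (- a * x\<^sup>2) powr q)"
proof (rule Bochner_Integration.integrable_bound)
  show "integrable lborel (\<lambda>x. 2 / a * q_exp q (- (a / 2) * x\<^sup>2))"
    using q_profile_integrable[OF int1, of "a / 2"] a by (intro integrable_mult_right) auto
  show "AE x in lborel. norm (x\<^sup>2 * q_exp q (- a * x\<^sup>2) powr q)
      \<le> norm (2 / a * q_exp q (- (a / 2) * x\<^sup>2))"
    using q_profile_square_bound a by (simp add: q_exp_nonneg abs_mult)
qed measurable

lemma q_profile_variance_integrable:
  "integrable lborel (\<lambda>x. x\<^sup>2 * q_exp q (- a * x\<^sup>2) powr (2 * q - 1))"
proof (rule Bochner_Integration.integrable_bound[OF q_profile_square_integrable])
  have "x\<^sup>2 * q_exp q (- a * x\<^sup>2) powr (2 * q - 1) \<le> x\<^sup>2 * q_exp q (- a * x\<^sup>2) powr q" for x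
    using q_exp_powr_le[OF q, of "- a * x\<^sup>2" q "2 * q - 1"] a q
    by (intro mult_left_mono) auto
  then show "AE x in lborel. norm (x\<^sup>2 * q_exp q (- a * x\<^sup>2) powr (2 * q - 1))
      \<le> norm (x\<^sup>2 * q_exp q (- a * x\<^sup>2) powr q)"
    by (simp add: abs_mult)
qed measurable

lemma q_profile_mean_integrable:
  "integrable lborel (\<lambda>x. x * q_exp q (- a * x\<^sup>2) powr q)"
proof (rule Bochner_Integration.integrable_bound)
  show "integrable lborel (\<lambda>x. q_exp q (- a * x\<^sup>2) powr q + x\<^sup>2 * q_exp q (- a * x\<^sup>2) powr q)"
    by (intro Bochner_Integration.integrable_add q_profile_powr_integrable
        q_profile_square_integrable q)
  \<comment> \<open>\<open>\<bar>x\<bar> \<le> 1 + x\<^sup>2\<close>, so the zeroth and the second moment together dominate the first.\<close>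
  have "\<bar>x\<bar> * q_exp q (- a * x\<^sup>2) powr q \<le> (1 + x\<^sup>2) * q_exp q (- a * x\<^sup>2) powr q" for x
  proof (rule mult_right_mono)
    have "0 \<le> (\<bar>x\<bar> - 1)\<^sup>2" by simp
    then have "2 * \<bar>x\<bar> \<le> 1 + x\<^sup>2" by (simp add: power2_diff)
    then show "\<bar>x\<bar> \<le> 1 + x\<^sup>2" by linarith
  qed simp
  then show "AE x in lborel. norm (x * q_exp q (- a * x\<^sup>2) powr q)
      \<le> norm (q_exp q (- a * x\<^sup>2) powr q + x\<^sup>2 * q_exp q (- a * x\<^sup>2) powr q)"
    by (simp add: abs_mult distrib_right)
qed measurable

lemma q_profile_mean_integral:
  "(\<integral>x. x * q_exp q (- a * x\<^sup>2) powr q \<partial>lborel) = 0"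
  using lborel_integral_real_affine[of "-1" "\<lambda>x. x * q_exp q (- a * x\<^sup>2) powr q" 0] by simp

lemma q_profile_derivative:
  "((\<lambda>x. x * q_exp q (- a * x\<^sup>2) powr q) has_real_derivative
    q_exp q (- a * x\<^sup>2) powr q - 2 * a * q * (x\<^sup>2 * q_exp q (- a * x\<^sup>2) powr (2 * q - 1))) (at x)"
proof -
  let ?u = "- a * x\<^sup>2"
  have u: "?u \<le> 0" using a by simp
  have E: "((\<lambda>x. q_exp q (- a * x\<^sup>2)) has_real_derivative
      q_exp q ?u powr q * (- (2 * a * x))) (at x)"
    by (rule DERIV_chain2[where f = "q_exp q" and g = "\<lambda>x. - a * x\<^sup>2" and x = x, OF q_exp_has_real_derivative[OF q u]])
       (auto intro!: derivative_eq_intros)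
  have "q_exp q ?u powr (q - 1) * q_exp q ?u powr q = q_exp q ?u powr (2 * q - 1)"
    by (simp flip: powr_add)
  then show ?thesis
    by - (rule derivative_eq_intros E refl q_exp_pos[OF q u]
      | simp add: power2_eq_square algebra_simps)+
qed

text \<open>\<open>x\<^sup>2 E(x)\<^sup>q\<close> is at most \<open>2 / a\<close>, so \<open>x E(x)\<^sup>q\<close> decays like \<open>1 / x\<close>; stated along a
  filter so that it serves both ends of the line.\<close>

lemma q_profile_boundary_term:
  assumes "filterlim f at_infinity F"
  shows "((\<lambda>y. f y * q_exp q (- a * (f y)\<^sup>2) powr q) \<longlongrightarrow> 0) F"
proof (rule Lim_null_comparison)
  show "((\<lambda>y. norm (2 / a / f y)) \<longlongrightarrow> 0) F"
    by (rule tendsto_norm_zero tendsto_divide_0[OF tendsto_const assms])+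
  have "norm (x * q_exp q (- a * x\<^sup>2) powr q) \<le> norm (2 / a / x)" for x
  proof (cases "x = 0")
    case False
    have "2 / a * q_exp q (- (a / 2) * x\<^sup>2) \<le> 2 / a * 1"
      using q_exp_le_1[OF q, of "- (a / 2) * x\<^sup>2"] a by (intro mult_left_mono) auto
    then have "x\<^sup>2 * q_exp q (- a * x\<^sup>2) powr q \<le> 2 / a"
      using q_profile_square_bound[of x] by linarith
    then have "\<bar>x\<bar> * (\<bar>x\<bar> * q_exp q (- a * x\<^sup>2) powr q) \<le> 2 / a"
      by (simp add: power2_eq_square flip: mult.assoc)
    then show ?thesis using False a by (simp add: abs_mult field_simps)
  qed simp
  then show "\<forall>\<^sub>F y in F. norm (f y * q_exp q (- a * (f y)\<^sup>2) powr q) \<le> norm (2 / a / f y)"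
    by simp
qed

text \<open>The derivative of \<open>x E(x)\<^sup>q\<close> integrates to its boundary values, which are \<open>0\<close>.\<close>

lemma q_profile_integration_by_parts:
  "(\<integral>x. q_exp q (- a * x\<^sup>2) powr q \<partial>lborel)
    = 2 * a * q * (\<integral>x. x\<^sup>2 * q_exp q (- a * x\<^sup>2) powr (2 * q - 1) \<partial>lborel)"
proof -
  let ?F = "\<lambda>x. x * q_exp q (- a * x\<^sup>2) powr q"
  let ?A = "\<lambda>x. q_exp q (- a * x\<^sup>2) powr q"
  let ?B = "\<lambda>x. x\<^sup>2 * q_exp q (- a * x\<^sup>2) powr (2 * q - 1)"
  have int: "integrable lborel (\<lambda>x. ?A x - 2 * a * q * ?B x)"
    by (intro Bochner_Integration.integrable_diff integrable_mult_right
        q_profile_powr_integrable q q_profile_variance_integrable)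
  have cont: "isCont (\<lambda>x. q_exp q (- a * x\<^sup>2)) x" for x
    by (rule isCont_o2[where g = "q_exp q"])
       (use a in \<open>auto intro!: continuous_intros DERIV_isCont[OF q_exp_has_real_derivative[OF q]]\<close>)
  have nz: "q_exp q (- a * x\<^sup>2) \<noteq> 0" for x
    using q_exp_pos[OF q, of "- a * x\<^sup>2"] a by simp
  have "(LBINT x=-\<infinity>..\<infinity>. ?A x - 2 * a * q * ?B x) = 0 - 0"
  proof (rule interval_integral_FTC_integrable)
    show "(?F has_vector_derivative ?A x - 2 * a * q * ?B x) (at x)" for x
      using q_profile_derivative[of x]
      by (simp add: has_real_derivative_iff_has_vector_derivative)
    show "isCont (\<lambda>x. ?A x - 2 * a * q * ?B x) x" for x
      by (intro continuous_intros cont nz)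
    show "set_integrable lborel (einterval (-\<infinity>) \<infinity>) (\<lambda>x. ?A x - 2 * a * q * ?B x)"
      using int by (simp add: set_integrable_def)
    show "((?F \<circ> real_of_ereal) \<longlongrightarrow> 0) (at_right (-\<infinity>))"
      using q_profile_boundary_term[of "\<lambda>x. x" at_bot] filterlim_ident
      by (auto simp: ereal_tendsto_simps intro: filterlim_mono at_bot_le_at_infinity)
    show "((?F \<circ> real_of_ereal) \<longlongrightarrow> 0) (at_left \<infinity>)"
      using q_profile_boundary_term[of "\<lambda>x. x" at_top] filterlim_ident
      by (auto simp: ereal_tendsto_simps intro: filterlim_mono at_top_le_at_infinity)
  qed simp
  then have "(\<integral>x. ?A x - 2 * a * q * ?B x \<partial>lborel) = 0"
    by (simp add: interval_lebesgue_integral_def set_lebesgue_integral_def)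
  moreover have "(\<integral>x. ?A x - 2 * a * q * ?B x \<partial>lborel)
      = (\<integral>x. ?A x \<partial>lborel) - 2 * a * q * (\<integral>x. ?B x \<partial>lborel)"
    using q_profile_powr_integrable[OF q] q_profile_variance_integrable
    by (subst Bochner_Integration.integral_diff) auto
  ultimately show ?thesis by simp
qed

text \<open>Integrating the relation between \<open>E\<^sup>q\<close> and \<open>E\<^bsup>2q-1\<^esup>\<close> gives a second expression for
  \<open>\<integral> E\<^sup>q\<close>; equating it with the one from integration by parts is a linear equation for the
  variance integral.\<close>

lemma q_profile_variance_integral:
  "(\<integral>x. x\<^sup>2 * q_exp q (- a * x\<^sup>2) powr (2 * q - 1) \<partial>lborel)
    = (\<integral>x. q_exp q (- a * x\<^sup>2) powr (2 * q - 1) \<partial>lborel) / (a * (q + 1))"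
proof -
  let ?V = "\<integral>x. x\<^sup>2 * q_exp q (- a * x\<^sup>2) powr (2 * q - 1) \<partial>lborel"
  let ?N = "\<integral>x. q_exp q (- a * x\<^sup>2) powr (2 * q - 1) \<partial>lborel"
  have "q_exp q (- a * x\<^sup>2) powr q = q_exp q (- a * x\<^sup>2) powr (2 * q - 1)
      + (q - 1) * a * (x\<^sup>2 * q_exp q (- a * x\<^sup>2) powr (2 * q - 1))" for x
    using q_exp_powr_order_relation[OF q, of "- a * x\<^sup>2"] a by (simp add: algebra_simps)
  then have "(\<integral>x. q_exp q (- a * x\<^sup>2) powr q \<partial>lborel) = (\<integral>x. q_exp q (- a * x\<^sup>2) powr (2 * q - 1)
      + (q - 1) * a * (x\<^sup>2 * q_exp q (- a * x\<^sup>2) powr (2 * q - 1)) \<partial>lborel)"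
    by presburger
  also have "\<dots> = ?N + (q - 1) * a * ?V"
    using q_profile_powr_integrable[of "2 * q - 1"] q_profile_variance_integrable q
    by (subst Bochner_Integration.integral_add) auto
  finally have "2 * a * q * ?V = ?N + (q - 1) * a * ?V"
    by (simp only: q_profile_integration_by_parts)
  then have "?V * (a * (q + 1)) = ?N" by (simp add: algebra_simps)
  then show ?thesis using a q by (simp add: nonzero_eq_divide_eq)
qed

end

section \<open>Densities proportional to a shifted profile\<close>

lemma shifted_integrable:
  fixes h :: "real \<Rightarrow> real"
  assumes "integrable lborel h"
  shows "integrable lborel (\<lambda>x. h (x - m))"
  using lborel_integrable_real_affine[OF assms, of 1 "- m"] by simp

lemma shifted_integral:
  fixes h :: "real \<Rightarrow> real"
  shows "(\<integral>x. h (x - m) \<partial>lborel) = (\<integral>x. h x \<partial>lborel)"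
  using lborel_integral_real_affine[of 1 h "- m"] by simp

text \<open>The escort density does not see the normalizing constant \<open>K\<close>: its \<open>r\<close>-th power cancels
  against the same factor in \<open>\<nu>\<^sub>r\<close>. Hence the weighted integrals of an escort density reduce to
  those of the profile \<open>E\<close> centred at the origin.\<close>

lemma escort_of_shifted_profile:
  fixes f E w :: "real \<Rightarrow> real"
  assumes f [measurable]: "f \<in> borel_measurable borel"
    and E [measurable]: "E \<in> borel_measurable borel"
    and w [measurable]: "w \<in> borel_measurable borel"
    and E0: "\<And>x. 0 \<le> E x" and K: "0 < K"
    and ae: "AE x in lborel. f x = K * E (x - m)"
    and intE: "integrable lborel (\<lambda>x. E x powr r)"
    and intw: "integrable lborel (\<lambda>x. w x * E x powr r)"
  shows "integrable lborel (\<lambda>x. f x powr r)"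
    and "integrable lborel (\<lambda>x. w (x - m) * escort_density r f x)"
    and "(\<integral>x. w (x - m) * escort_density r f x \<partial>lborel)
          = (\<integral>x. w x * E x powr r \<partial>lborel) / (\<integral>x. E x powr r \<partial>lborel)"
proof -
  have aer: "AE x in lborel. f x powr r = K powr r * E (x - m) powr r"
    using ae by eventually_elim (use K E0 in \<open>simp add: powr_mult\<close>)
  have "integrable lborel (\<lambda>x. K powr r * E (x - m) powr r)"
    by (intro integrable_mult_right shifted_integrable[OF intE])
  then show "integrable lborel (\<lambda>x. f x powr r)"
    using aer by (subst integrable_cong_AE[OF _ _ aer]) auto
  have "nu r f = (\<integral>x. K powr r * E (x - m) powr r \<partial>lborel)"
    unfolding nu_def by (rule integral_cong_AE[OF _ _ aer]) auto
  also have "\<dots> = K powr r * (\<integral>x. E x powr r \<partial>lborel)"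
    using shifted_integral[of "\<lambda>x. E x powr r" m] by simp
  finally have nu: "nu r f = K powr r * (\<integral>x. E x powr r \<partial>lborel)" .
  let ?I = "\<integral>x. E x powr r \<partial>lborel"
  have aew: "AE x in lborel. w (x - m) * escort_density r f x
      = w (x - m) * E (x - m) powr r / ?I"
    using aer by eventually_elim (use K in \<open>simp add: escort_density_def nu\<close>)
  have meas: "(\<lambda>x. w (x - m) * escort_density r f x) \<in> borel_measurable lborel"
    unfolding escort_density_def by measurable
  have "integrable lborel (\<lambda>x. w (x - m) * E (x - m) powr r / ?I)"
    by (intro integrable_divide_zero shifted_integrable[OF intw])
  then show "integrable lborel (\<lambda>x. w (x - m) * escort_density r f x)"
    by (subst integrable_cong_AE[OF meas _ aew]) auto
  have "(\<integral>x. w (x - m) * escort_density r f x \<partial>lborel)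
      = (\<integral>x. w (x - m) * E (x - m) powr r / ?I \<partial>lborel)"
    by (rule integral_cong_AE[OF meas _ aew]) auto
  also have "\<dots> = (\<integral>x. w x * E x powr r \<partial>lborel) / ?I"
    using shifted_integral[of "\<lambda>x. w x * E x powr r" m] by simp
  finally show "(\<integral>x. w (x - m) * escort_density r f x \<partial>lborel)
      = (\<integral>x. w x * E x powr r \<partial>lborel) / ?I" .
qed

theorem proposition5p5:
  fixes M :: "'a measure" and X :: "'a \<Rightarrow> real" and f :: "real \<Rightarrow> real"
    and q m \<sigma> :: real
  assumes "prob_space M"
    and "1 \<le> q" and "q < 3" and "0 < \<sigma>"
    and "distr M lborel X = q_gaussian q m \<sigma>"
    and "distributed M lborel X (\<lambda>x. ennreal (f x))"
    and "\<And>x. 0 \<le> f x"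
  shows "(integrable lborel (\<lambda>x. f x powr q) \<and>
          integrable lborel (\<lambda>x. x * escort_density q f x) \<and>
          normalized_mean q f = m) \<and>
         (integrable lborel (\<lambda>x. f x powr (2 * q - 1)) \<and>
          integrable lborel (\<lambda>x. (x - m)\<^sup>2 * escort_density (2 * q - 1) f x) \<and>
          normalized_variance (2 * q - 1) m f = (3 - q) / (q + 1) * \<sigma>\<^sup>2)"
proof -
  interpret prob_space M by fact
  note q = \<open>1 \<le> q\<close>
  define a where "a = 1 / ((3 - q) * \<sigma>\<^sup>2)"
  define K where "K = sqrt (1 / (3 - q)) / (\<sigma> * q_gaussian_const q)"
  let ?E = "\<lambda>x. q_exp q (- a * x\<^sup>2)"
  have a: "0 < a" using assms(3,4) by (simp add: a_def)
  have dens: "q_gaussian_density q m \<sigma> x = K * ?E (x - m)" for x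
    by (simp add: q_gaussian_density_def Let_def K_def a_def)
  have X: "X \<in> measurable M lborel" by (rule distributed_measurable[OF assms(6)])
  have "distributed M lborel X (\<lambda>x. ennreal (q_gaussian_density q m \<sigma> x))"
    unfolding distributed_def using X assms(5) by (simp add: q_gaussian_def dens)
  then have ae: "AE x in lborel. ennreal (f x) = ennreal (q_gaussian_density q m \<sigma> x)"
    by (rule distributed_unique[OF assms(6)])
  \<comment> \<open>If \<open>C\<^sub>q\<close> were \<open>0\<close>, in particular if \<open>e\<^sub>q(-x\<^sup>2)\<close> were not integrable (the Bochner
    integral is then \<open>0\<close> by convention), division by zero would make the density vanish
    identically, which a probability law cannot do.\<close>
  have C: "q_gaussian_const q \<noteq> 0"
  proof
    assume "q_gaussian_const q = 0"
    then have "q_gaussian q m \<sigma> = density lborel (\<lambda>x. 0)"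
      by (simp add: q_gaussian_def dens K_def)
    then have "emeasure (distr M lborel X) UNIV = 0"
      using assms(5) by (simp add: emeasure_density)
    moreover have "emeasure (distr M lborel X) (space (distr M lborel X)) = 1"
      by (rule prob_space.emeasure_space_1[OF prob_space_distr[OF X]])
    ultimately show False by simp
  qed
  then have int1: "integrable lborel (\<lambda>x. q_exp q (- x\<^sup>2))"
    unfolding q_gaussian_const_def using not_integrable_integral_eq by blast
  have "0 \<le> q_gaussian_const q"
    by (simp add: q_gaussian_const_def q_exp_nonneg)
  with C have K: "0 < K" using assms(3,4) by (simp add: K_def)
  have ae': "AE x in lborel. f x = K * ?E (x - m)"
    using ae by eventually_elim (use K assms(7) in \<open>simp add: dens q_exp_nonneg\<close>)
  have "(\<lambda>x. enn2real (ennreal (f x))) \<in> borel_measurable lborel"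
    using assms(6) unfolding distributed_def by (intro borel_measurable_enn2real) simp
  then have f: "f \<in> borel_measurable borel" using assms(7) by simp
  have E: "?E \<in> borel_measurable borel" by measurable
  note profile = q_profile_powr_integrable[OF q a int1] q_profile_powr_integral_pos[OF q a int1]
  note escort = escort_of_shifted_profile[OF f E _ q_exp_nonneg K ae']
  have q2: "1 \<le> 2 * q - 1" using q by simp

  have fq: "integrable lborel (\<lambda>x. f x powr q)"
    by (rule escort(1)[where w = "\<lambda>_. 1"]) (use q profile(1) in auto)
  have mean0: "integrable lborel (\<lambda>x. 1 * escort_density q f x)"
    by (rule escort(2)[where w = "\<lambda>_. 1"]) (use q profile(1) in auto)
  have mass: "(\<integral>x. 1 * escort_density q f x \<partial>lborel) = 1"
    by (subst escort(3)[where w = "\<lambda>_. 1"]) (use q profile(1) profile(2)[OF q] in auto)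
  have mean1: "integrable lborel (\<lambda>x. (x - m) * escort_density q f x)"
    by (rule escort(2)[where w = "\<lambda>x. x"])
       (use q profile(1) q_profile_mean_integrable[OF q a int1] in auto)
  have mean1': "(\<integral>x. (x - m) * escort_density q f x \<partial>lborel) = 0"
    by (subst escort(3)[where w = "\<lambda>x. x"])
       (use q profile(1) q_profile_mean_integrable[OF q a int1]
          q_profile_mean_integral[OF q a int1] in auto)
  \<comment> \<open>The mean is split around \<open>m\<close>; the constant part needs total mass 1 of the escort
    density, that is, \<open>\<nu>\<^sub>q \<noteq> 0\<close>.\<close>
  have split: "(\<lambda>x. x * escort_density q f x)
      = (\<lambda>x. (x - m) * escort_density q f x + m * escort_density q f x)"
    by (simp add: algebra_simps)
  have mean: "integrable lborel (\<lambda>x. x * escort_density q f x)"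
    unfolding split using mean0 mean1 by simp
  have "normalized_mean q f = m"
    unfolding normalized_mean_def split using mean0 mean1 mean1' mass by simp
  moreover have "integrable lborel (\<lambda>x. f x powr (2 * q - 1))"
    by (rule escort(1)[where w = "\<lambda>_. 1"]) (use q2 profile(1) in auto)
  moreover have "integrable lborel (\<lambda>x. (x - m)\<^sup>2 * escort_density (2 * q - 1) f x)"
    by (rule escort(2)[where w = "\<lambda>x. x\<^sup>2"])
       (use profile(1)[OF q2] q_profile_variance_integrable[OF q a int1] in auto)
  moreover have "normalized_variance (2 * q - 1) m f = (3 - q) / (q + 1) * \<sigma>\<^sup>2"
  proof -
    have "normalized_variance (2 * q - 1) m f = 1 / (a * (q + 1))"
      unfolding normalized_variance_def
      by (subst escort(3)[where w = "\<lambda>x. x\<^sup>2"])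
         (use profile(1)[OF q2] profile(2)[OF q2] q_profile_variance_integrable[OF q a int1]
            q_profile_variance_integral[OF q a int1] in auto)
    then show ?thesis using assms(3) by (simp add: a_def)
  qed
  ultimately show ?thesis using fq mean by blast
qed

end
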